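(* Let $(B_t)_{t\ge 0}$ be a standard Brownian motion in $\mathbb{R}^d$, $d\geq 1$. Let $f:[0,1]\to\mathbb{R}^d$ be a càdlàg function and let $A$ be a non-empty subset of $[0,1]$. Then there exist (deterministic) constants $c_1$ and $c_2$ such that, almost surely, $$\underline{\dim}_M (B+f)(A) = c_1 \quad\text{and}\quad \overline{\dim}_M (B+f)(A) = c_2.$$
   Context: For a function $h$ on $[0,1]$ and $A\subseteq[0,1]$, $h(A)=\{h(t):t\in A\}$ denotes the image; $(B+f)(t)=B_t+f(t)$. For a non-empty bounded set $E\subset\mathbb{R}^m$ and $\epsilon>0$, let $P(E,\epsilon)$ be the maximum number of pairwise disjoint balls of radius $\epsilon$ with centers in $E$. The upper and lower Minkowski (box) dimensions of $E$ are $$\overline{\dim}_M(E)=\limsup_{\epsilon\to 0}\frac{\log P(E,\epsilon)}{\log \epsilon^{-1}},\qquad \underline{\dim}_M(E)=\liminf_{\epsilon\to 0}\frac{\log P(E,\epsilon)}{\log \epsilon^{-1}}.$$ *)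

theory Defs
  imports "HOL-Probability.Probability"
begin

(* "Standard" means started at 0. The path regularity and the starting point are only
   required almost surely, and nothing is assumed about B t for t < 0. The density below
   is that of the normal distribution N(0, (t - s) I) on the d-dimensional space 'a. *)
locale standard_brownian_motion = prob_space M
  for M :: "'w measure" +
  fixes B :: "real \<Rightarrow> 'w \<Rightarrow> 'a::euclidean_space"
  assumes measurable_B: "\<And>t. 0 \<le> t \<Longrightarrow> random_variable borel (B t)"
    and start_B: "AE \<omega> in M. B 0 \<omega> = 0"
    and indep_increments_B:
      "\<And>(n::nat) (\<tau>::nat \<Rightarrow> real). 0 \<le> \<tau> 0 \<Longrightarrow> (\<And>i. i < n \<Longrightarrow> \<tau> i < \<tau> (Suc i)) \<Longrightarrow>
        indep_vars (\<lambda>_. borel) (\<lambda>i \<omega>. B (\<tau> (Suc i)) \<omega> - B (\<tau> i) \<omega>) {..<n}"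
    and normal_increments_B:
      "\<And>s t. 0 \<le> s \<Longrightarrow> s < t \<Longrightarrow>
        distributed M lborel (\<lambda>\<omega>. B t \<omega> - B s \<omega>)
          (\<lambda>x. ennreal (\<Prod>b\<in>Basis. normal_density 0 (sqrt (t - s)) (x \<bullet> b)))"
    and continuous_B: "AE \<omega> in M. continuous_on {0..} (\<lambda>t. B t \<omega>)"

(* Only the values of f on {a..b} matter: the one-sided limits are taken at points
   from which the relevant side stays inside the interval. *)
definition cadlag_on :: "real \<Rightarrow> real \<Rightarrow> (real \<Rightarrow> 'a::topological_space) \<Rightarrow> bool" where
  "cadlag_on a b f \<longleftrightarrow>
    (\<forall>t\<in>{a..<b}. (f \<longlongrightarrow> f t) (at_right t)) \<and>
    (\<forall>t\<in>{a<..b}. \<exists>l. (f \<longlongrightarrow> l) (at_left t))"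

(* Balls are open. A family of balls is given by its set C of centers; the maximum
   exists whenever E is bounded and \<epsilon> > 0. *)
definition packing_number :: "'a::euclidean_space set \<Rightarrow> real \<Rightarrow> nat" where
  "packing_number E \<epsilon> =
    Max {card C |C. finite C \<and> C \<subseteq> E \<and> pairwise (\<lambda>x y. disjnt (ball x \<epsilon>) (ball y \<epsilon>)) C}"

definition upper_minkowski_dim :: "'a::euclidean_space set \<Rightarrow> ereal" where
  "upper_minkowski_dim E =
    Limsup (at_right 0) (\<lambda>\<epsilon>. ereal (ln (real (packing_number E \<epsilon>)) / ln (inverse \<epsilon>)))"

definition lower_minkowski_dim :: "'a::euclidean_space set \<Rightarrow> ereal" where
  "lower_minkowski_dim E =
    Liminf (at_right 0) (\<lambda>\<epsilon>. ereal (ln (real (packing_number E \<epsilon>)) / ln (inverse \<epsilon>)))"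

end

(*
  Let N(S) be the packing number of (B + f)(S) at scale e. Stop when the points visited so
  far first contain a packing of size m. The remaining points are governed by independent
  increments and N is translation invariant, so P(N(A) >= m + l) <= P(N(A) >= m) P(N(A) >= l).
  Hence N(A) is concentrated up to polynomial factors: at scale 2^-k take the quantile N_k with
  P(N(A) >= N_k) about 1 - 1/k^2; then P(N(A) >= 2 k^3 N_k) <= (1 - 1/k^2)^(k^3) <= exp(-k).
  By Borel-Cantelli, almost surely N_k <= N(A) <= 2 k^3 N_k for all large k, and a polynomial
  factor is invisible to log N(A) / log(2^k). So both dimensions are the liminf and limsup of
  the deterministic sequence log N_k / log(2^k).
*)
theory Submission
  imports Defs "HOL-Real_Asymp.Real_Asymp"
begin

text \<open>\<open>A\<close> is arbitrary and possibly uncountable, so the event of a large packing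
  is not evidently measurable, and the points cannot be visited one by one. Both obstacles are met
  by a countable \<open>A'\<close> over which the graph of \<open>f\<close> is dense in the graph
  over \<open>A\<close>: by path continuity, (B + f)(A') is then almost surely dense in (B + f)(A).
  Passing to a dense subset costs a factor 2 in the scale, hence one dyadic index; this is the
  origin of \<open>Suc k\<close> in the upper estimates. Even countably many times may have no
  successor structure, so first passage is carried out on finite subsets and transferred by a
  monotone limit. Packings depend only on differences of positions, so independent increments take
  the place of a strong Markov property, and \<open>f\<close> merely shifts each increment by a
  constant. The cadlag hypothesis enters through boundedness of \<open>f\<close> on [0,1]: packing
  numbers are then finite, and volume comparison bounds the exponents, so that both constants are
  real numbers.\<close>

subsection \<open>Packings\<close>

text \<open>Packings are sets of indices rather than of points, so that the time order survives and
  a packing can be cut at a passage time. A predicate in \<open>m\<close>, unlike a maximum, is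
  meaningful before finiteness is known. Balls of radius \<epsilon> correspond to \<open>r\<close> =
  2\<epsilon>.\<close>

definition has_packing :: "('i \<Rightarrow> 'a::metric_space) \<Rightarrow> real \<Rightarrow> 'i set \<Rightarrow> nat \<Rightarrow> bool" where
  "has_packing y r I m \<longleftrightarrow>
    (\<exists>T. finite T \<and> T \<subseteq> I \<and> card T = m \<and> (\<forall>i\<in>T. \<forall>j\<in>T. i \<noteq> j \<longrightarrow> r \<le> dist (y i) (y j)))"

lemma has_packing_mono:
  assumes "has_packing y r I m" "I \<subseteq> J" "m' \<le> m" "r' \<le> r"
  shows "has_packing y r' J m'"
proof -
  obtain T where T: "finite T" "T \<subseteq> I" "card T = m"
    "\<forall>i\<in>T. \<forall>j\<in>T. i \<noteq> j \<longrightarrow> r \<le> dist (y i) (y j)"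
    using assms(1) unfolding has_packing_def by blast
  have "m' \<le> card T"
    using T(3) assms(3) by simp
  then obtain S where S: "S \<subseteq> T" "card S = m'"
    by (rule obtain_subset_with_card_n)
  show ?thesis
    unfolding has_packing_def
  proof (intro exI conjI)
    show "finite S" using S(1) T(1) by (rule finite_subset)
    show "\<forall>i\<in>S. \<forall>j\<in>S. i \<noteq> j \<longrightarrow> r' \<le> dist (y i) (y j)"
      using S(1) T(4) assms(4) by force
  qed (use S T(2) assms(2) in auto)
qed

lemma has_packing_0 [simp]: "has_packing y r I 0"
  unfolding has_packing_def by (intro exI[of _ "{}"]) auto

lemma has_packing_1: "I \<noteq> {} \<Longrightarrow> has_packing y r I 1"
  unfolding has_packing_def
proof -
  assume "I \<noteq> {}"
  then obtain i where "i \<in> I" by blast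
  then show "\<exists>T. finite T \<and> T \<subseteq> I \<and> card T = 1 \<and> (\<forall>i\<in>T. \<forall>j\<in>T. i \<noteq> j \<longrightarrow> r \<le> dist (y i) (y j))"
    by (intro exI[of _ "{i}"]) auto
qed

lemma has_packing_empty_iff [simp]: "has_packing y r {} m \<longleftrightarrow> m = 0"
  unfolding has_packing_def by auto

lemma has_packing_cong:
  assumes "\<And>i j. i \<in> I \<Longrightarrow> j \<in> I \<Longrightarrow> dist (y i) (y j) = dist (z i) (z j)"
  shows "has_packing y r I m \<longleftrightarrow> has_packing z r I m"
  unfolding has_packing_def
  by (intro ex_cong1 conj_cong refl ball_cong imp_cong) (use assms in \<open>auto simp: subset_eq\<close>)

lemma has_packing_comp:
  assumes "inj_on h I"
  shows "has_packing (\<lambda>i. y (h i)) r I m \<longleftrightarrow> has_packing y r (h ` I) m"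
proof
  assume "has_packing (\<lambda>i. y (h i)) r I m"
  then obtain T where T: "finite T" "T \<subseteq> I" "card T = m"
    "\<forall>i\<in>T. \<forall>j\<in>T. i \<noteq> j \<longrightarrow> r \<le> dist (y (h i)) (y (h j))"
    unfolding has_packing_def by blast
  show "has_packing y r (h ` I) m"
    unfolding has_packing_def
  proof (intro exI[of _ "h ` T"] conjI)
    show "card (h ` T) = m"
      using T assms by (metis card_image inj_on_subset)
  qed (use T in \<open>auto simp: subset_iff\<close>)
next
  assume "has_packing y r (h ` I) m"
  then obtain T where T: "finite T" "T \<subseteq> h ` I" "card T = m"
    "\<forall>i\<in>T. \<forall>j\<in>T. i \<noteq> j \<longrightarrow> r \<le> dist (y i) (y j)"
    unfolding has_packing_def by blast
  obtain S where S: "S \<subseteq> I" "T = h ` S"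
    using T(2) by (meson subset_image_iff)
  have inj: "inj_on h S"
    using assms S(1) inj_on_subset by blast
  show "has_packing (\<lambda>i. y (h i)) r I m"
    unfolding has_packing_def
  proof (intro exI[of _ S] conjI)
    show "finite S" using T(1) S inj by (simp add: finite_image_iff)
    show "card S = m" using T(3) S inj by (simp add: card_image)
    show "\<forall>i\<in>S. \<forall>j\<in>S. i \<noteq> j \<longrightarrow> r \<le> dist (y (h i)) (y (h j))"
      using T(4) S inj by (auto simp: inj_on_eq_iff)
  qed (use S in auto)
qed

text \<open>For positive \<open>r\<close> the indices of a packing have distinct values, and
  conversely a set of indices representing each value once carries every packing of the
  image.\<close>

lemma has_packing_image:
  assumes "0 < r"
  shows "has_packing (\<lambda>x. x) r (y ` I) m \<longleftrightarrow> has_packing y r I m"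
proof
  assume "has_packing (\<lambda>x. x) r (y ` I) m"
  moreover obtain J where J: "J \<subseteq> I" "y ` I = y ` J" "inj_on y J"
    by (metis order_refl subset_image_inj)
  ultimately have "has_packing y r J m"
    using has_packing_comp[OF J(3), of "\<lambda>x. x"] by simp
  then show "has_packing y r I m"
    using J(1) by (rule has_packing_mono) auto
next
  assume "has_packing y r I m"
  then obtain T where T: "finite T" "T \<subseteq> I" "card T = m"
    "\<forall>i\<in>T. \<forall>j\<in>T. i \<noteq> j \<longrightarrow> r \<le> dist (y i) (y j)"
    unfolding has_packing_def by blast
  have "inj_on y T"
    using T(4) assms by (force simp: inj_on_def)
  moreover have "has_packing y r T m"
    unfolding has_packing_def using T by blast
  ultimately have "has_packing (\<lambda>x. x) r (y ` T) m"
    using has_packing_comp[of y T "\<lambda>x. x"] by simp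
  then show "has_packing (\<lambda>x. x) r (y ` I) m"
    by (rule has_packing_mono) (use T in auto)
qed

text \<open>Moving each center by less than r/2 shortens mutual distances by less than r, so
  separation 2r becomes at least r.\<close>

lemma has_packing_dense:
  assumes "has_packing (\<lambda>x. x) (2 * r) E m" "E \<subseteq> closure D" "0 < r"
  shows "has_packing (\<lambda>x. x) r D m"
proof -
  have "\<exists>g. \<forall>x\<in>E. g x \<in> D \<and> dist (g x) x < r / 2"
    using assms(2,3) by (intro bchoice) (metis closure_approachable half_gt_zero subsetD)
  then obtain g where g: "\<And>x. x \<in> E \<Longrightarrow> g x \<in> D" "\<And>x. x \<in> E \<Longrightarrow> dist (g x) x < r / 2"
    by blast
  obtain T where T: "finite T" "T \<subseteq> E" "card T = m"
    "\<forall>i\<in>T. \<forall>j\<in>T. i \<noteq> j \<longrightarrow> 2 * r \<le> dist i j"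
    using assms(1) unfolding has_packing_def by blast
  have "r \<le> dist (g i) (g j)" if "i \<in> T" "j \<in> T" "i \<noteq> j" for i j
  proof -
    have "2 * r \<le> dist i j" using T(4) that by blast
    also have "\<dots> \<le> dist (g i) i + dist (g i) (g j) + dist (g j) j"
      by metric
    finally show ?thesis
      using g(2)[of i] g(2)[of j] that T(2) by (auto simp: subset_iff)
  qed
  then have "has_packing g r T m"
    unfolding has_packing_def using T by blast
  then have "has_packing (\<lambda>x. x) r (g ` T) m"
    using has_packing_image[OF assms(3)] by blast
  then show ?thesis
    by (rule has_packing_mono) (use g T in auto)
qed

text \<open>If \<open>i\<close> is the first index at which a packing of size \<open>m\<close> is
  available, a packing of size \<open>m + l\<close> has at most \<open>m - 1\<close> members before
  \<open>i\<close> and at most one at \<open>i\<close>. At least \<open>l\<close> therefore lie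
  strictly after \<open>i\<close>, so nothing is lost in the count although \<open>i\<close> itself
  is discarded.\<close>

lemma has_packing_first_passage:
  fixes y :: "nat \<Rightarrow> 'a::metric_space"
  assumes "has_packing y r {..n} (m + l)" "0 < m"
  obtains i where "i \<le> n" "has_packing y r {..i} m" "\<not> has_packing y r {..<i} m"
    "has_packing y r {i<..n} l"
proof -
  define i where "i = (LEAST i. has_packing y r {..i} m)"
  have n: "has_packing y r {..n} m"
    using assms(1) by (rule has_packing_mono) auto
  have i: "has_packing y r {..i} m" and "i \<le> n"
    unfolding i_def using n by (auto intro: LeastI Least_le)
  have ni: "\<not> has_packing y r {..<i} m"
  proof (cases i)
    case (Suc k)
    then have "\<not> has_packing y r {..k} m"
      unfolding i_def by (intro not_less_Least) simp
    then show ?thesis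
      using Suc by (simp add: lessThan_Suc_atMost)
  qed (use assms(2) in simp)
  obtain T where T: "finite T" "T \<subseteq> {..n}" "card T = m + l"
    "\<forall>i\<in>T. \<forall>j\<in>T. i \<noteq> j \<longrightarrow> r \<le> dist (y i) (y j)"
    using assms(1) unfolding has_packing_def by blast
  have "has_packing y r {..<i} (card (T \<inter> {..<i}))"
    unfolding has_packing_def using T by (intro exI[of _ "T \<inter> {..<i}"]) auto
  then have "card (T \<inter> {..<i}) < m"
    using ni has_packing_mono[OF _ order_refl _ order_refl] not_le by blast
  moreover have "(T \<inter> {..<i}) \<union> (T \<inter> {i}) \<union> (T \<inter> {i<..n}) = T"
    using T(2) by auto
  then have "card T \<le> card (T \<inter> {..<i}) + card (T \<inter> {i}) + card (T \<inter> {i<..n})"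
    using card_Un_le[of "(T \<inter> {..<i}) \<union> (T \<inter> {i})" "T \<inter> {i<..n}"]
      card_Un_le[of "T \<inter> {..<i}" "T \<inter> {i}"] by simp
  moreover have "card (T \<inter> {i}) \<le> 1"
    using card_mono[of "{i}" "T \<inter> {i}"] by simp
  ultimately have "l \<le> card (T \<inter> {i<..n})"
    using T(3) by linarith
  moreover have "has_packing y r {i<..n} (card (T \<inter> {i<..n}))"
    unfolding has_packing_def using T by (intro exI[of _ "T \<inter> {i<..n}"]) auto
  ultimately have "has_packing y r {i<..n} l"
    by (meson has_packing_mono order_refl)
  then show thesis
    using that i ni \<open>i \<le> n\<close> by blast
qed

section \<open>Packing numbers of bounded sets in Euclidean space\<close>

lemma disjnt_ball_iff:
  fixes x y :: "'a::euclidean_space"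
  assumes "0 < \<epsilon>"
  shows "disjnt (ball x \<epsilon>) (ball y \<epsilon>) \<longleftrightarrow> 2 * \<epsilon> \<le> dist x y"
proof
  assume disj: "disjnt (ball x \<epsilon>) (ball y \<epsilon>)"
  show "2 * \<epsilon> \<le> dist x y"
  proof (rule ccontr)
    assume "\<not> 2 * \<epsilon> \<le> dist x y"
    \<comment> \<open>In a Euclidean space two balls of equal radius meet as soon as their centers
      are closer than twice the radius: the midpoint lies in both.\<close>
    then have "midpoint x y \<in> ball x \<epsilon> \<inter> ball y \<epsilon>"
      by (simp add: dist_midpoint)
    then show False
      using disj by (auto simp: disjnt_def)
  qed
next
  assume "2 * \<epsilon> \<le> dist x y"
  then show "disjnt (ball x \<epsilon>) (ball y \<epsilon>)"
    unfolding disjnt_def by (intro disjoint_ballI) simp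
qed

text \<open>Disjoint balls of radius \<epsilon> \<le> 1 centered in a ball of radius R all fit into
  the ball of radius R + 1; comparing volumes bounds their number. This polynomial bound gives both
  finiteness of packing numbers and finiteness of the dimensions.\<close>

lemma has_packing_volume_bound:
  fixes E :: "'a::euclidean_space set"
  assumes "bounded E"
  obtains K where "0 < K"
    "\<And>\<epsilon> m. 0 < \<epsilon> \<Longrightarrow> \<epsilon> \<le> 1 \<Longrightarrow> has_packing (\<lambda>x. x) (2 * \<epsilon>) E m \<Longrightarrow> real m \<le> K / \<epsilon> ^ DIM('a)"
proof -
  obtain R where R: "0 < R" "E \<subseteq> ball 0 R"
    using assms bounded_subset_ballD by blast
  let ?v = "unit_ball_vol (real DIM('a))"
  have "real m \<le> (R + 1) ^ DIM('a) / \<epsilon> ^ DIM('a)"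
    if \<epsilon>: "0 < \<epsilon>" "\<epsilon> \<le> 1" and m: "has_packing (\<lambda>x. x) (2 * \<epsilon>) E m" for \<epsilon> m
  proof -
    obtain T where T: "finite T" "T \<subseteq> E" "card T = m"
      "\<forall>i\<in>T. \<forall>j\<in>T. i \<noteq> j \<longrightarrow> 2 * \<epsilon> \<le> dist i j"
      using m unfolding has_packing_def by blast
    have "disjoint_family_on (\<lambda>x. ball x \<epsilon>) T"
      unfolding disjoint_family_on_def
    proof (intro ballI impI)
      fix x y assume "x \<in> T" "y \<in> T" "x \<noteq> y"
      then have "2 * \<epsilon> \<le> dist x y"
        using T(4) by blast
      then show "ball x \<epsilon> \<inter> ball y \<epsilon> = {}"
        by (intro disjoint_ballI) simp
    qed
    moreover have "emeasure lborel (ball x \<epsilon>) \<noteq> \<infinity>" for x :: 'a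
      using emeasure_bounded_finite[OF bounded_ball] by (simp add: less_top)
    ultimately have "measure lborel (\<Union>x\<in>T. ball x \<epsilon>) = (\<Sum>x\<in>T. measure lborel (ball x \<epsilon>))"
      using T(1) by (intro measure_finite_Union) auto
    also have "\<dots> = real m * (?v * \<epsilon> ^ DIM('a))"
      using T(3) \<epsilon> by (simp add: content_ball)
    finally have "real m * (?v * \<epsilon> ^ DIM('a)) = measure lborel (\<Union>x\<in>T. ball x \<epsilon>)" ..
    also have "\<dots> \<le> measure lborel (ball (0::'a) (R + 1))"
    proof (rule measure_mono_fmeasurable)
      have "ball x \<epsilon> \<subseteq> ball 0 (R + 1)" if "x \<in> T" for x
      proof
        fix z assume "z \<in> ball x \<epsilon>"
        moreover have "dist 0 x < R"
          using that T(2) R(2) by auto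
        moreover have "dist 0 z \<le> dist 0 x + dist x z"
          by (rule dist_triangle)
        ultimately show "z \<in> ball 0 (R + 1)"
          using \<epsilon> by auto
      qed
      then show "(\<Union>x\<in>T. ball x \<epsilon>) \<subseteq> ball 0 (R + 1)" by blast
      show "(\<Union>x\<in>T. ball x \<epsilon>) \<in> sets lborel"
        using open_UN[of T "\<lambda>x. ball x \<epsilon>"] by simp
      show "ball 0 (R + 1) \<in> fmeasurable (lborel :: 'a measure)"
        using emeasure_bounded_finite[OF bounded_ball, of "0::'a" "R + 1"]
        by (intro fmeasurableI) (auto simp: less_top)
    qed
    also have "\<dots> = ?v * (R + 1) ^ DIM('a)"
      using R by (intro content_ball) auto
    finally have "?v * (real m * \<epsilon> ^ DIM('a)) \<le> ?v * (R + 1) ^ DIM('a)"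
      by (simp add: ac_simps)
    moreover have "0 < ?v" by simp
    ultimately have "real m * \<epsilon> ^ DIM('a) \<le> (R + 1) ^ DIM('a)"
      by (metis mult_le_cancel_left_pos)
    then show ?thesis
      using \<epsilon> by (simp add: pos_le_divide_eq)
  qed
  then show thesis
    using R(1) by (intro that[of "(R + 1) ^ DIM('a)"]) auto
qed

text \<open>\<open>Max\<close> says something only about a finite set, so the volume bound has to
  come first. Afterwards \<open>packing_number\<close> is accessed only through this
  equivalence.\<close>

lemma le_packing_number_iff:
  fixes E :: "'a::euclidean_space set"
  assumes "bounded E" "0 < \<epsilon>"
  shows "m \<le> packing_number E \<epsilon> \<longleftrightarrow> has_packing (\<lambda>x. x) (2 * \<epsilon>) E m"
proof -
  let ?S = "{m. has_packing (\<lambda>x. x) (2 * \<epsilon>) E m}"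
  have pairwise: "pairwise (\<lambda>x y. disjnt (ball x \<epsilon>) (ball y \<epsilon>)) C \<longleftrightarrow>
      (\<forall>x\<in>C. \<forall>y\<in>C. x \<noteq> y \<longrightarrow> 2 * \<epsilon> \<le> dist x y)" for C :: "'a set"
    by (simp add: pairwise_def disjnt_ball_iff[OF assms(2)])
  have eq: "packing_number E \<epsilon> = Max ?S"
    unfolding packing_number_def has_packing_def pairwise
    by (intro arg_cong[where f = Max] Collect_cong) blast
  obtain K where K: "\<And>\<epsilon> m. 0 < \<epsilon> \<Longrightarrow> \<epsilon> \<le> 1 \<Longrightarrow>
      has_packing (\<lambda>x. x) (2 * \<epsilon>) E m \<Longrightarrow> real m \<le> K / \<epsilon> ^ DIM('a)"
    using has_packing_volume_bound[OF assms(1)] by blast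
  \<comment> \<open>The volume bound covers scales up to 1; a packing at a larger scale is also one
    at scale 1.\<close>
  have "real m \<le> K / (min \<epsilon> 1) ^ DIM('a)" if "m \<in> ?S" for m
  proof (rule K)
    show "has_packing (\<lambda>x. x) (2 * min \<epsilon> 1) E m"
      using that has_packing_mono[of "\<lambda>x. x" "2 * \<epsilon>" E m E m "2 * min \<epsilon> 1"] by simp
  qed (use assms(2) in auto)
  then have "m \<le> nat \<lceil>K / (min \<epsilon> 1) ^ DIM('a)\<rceil>" if "m \<in> ?S" for m
    using that real_nat_ceiling_ge[of "K / (min \<epsilon> 1) ^ DIM('a)"] by (meson of_nat_le_iff order_trans)
  then have "finite ?S"
    by (intro finite_subset[OF _ finite_atMost]) blast
  moreover have "?S \<noteq> {}"
    by (auto intro: exI[of _ 0])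
  ultimately have Max: "Max ?S \<in> ?S" "m \<in> ?S \<Longrightarrow> m \<le> Max ?S" for m
    using Max_in Max_ge by blast+
  show ?thesis
    unfolding eq
  proof
    assume "m \<le> Max ?S"
    with Max(1) show "has_packing (\<lambda>x. x) (2 * \<epsilon>) E m"
      using has_packing_mono[of "\<lambda>x. x" "2 * \<epsilon>" E "Max ?S" E m "2 * \<epsilon>"] by simp
  qed (use Max(2) in simp)
qed

lemma packing_number_antimono:
  fixes E :: "'a::euclidean_space set"
  assumes "bounded E" "0 < \<delta>" "\<delta> \<le> \<epsilon>"
  shows "packing_number E \<epsilon> \<le> packing_number E \<delta>"
proof -
  have "has_packing (\<lambda>x. x) (2 * \<epsilon>) E (packing_number E \<epsilon>)"
    using le_packing_number_iff[of E \<epsilon> "packing_number E \<epsilon>"] assms by simp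
  then have "has_packing (\<lambda>x. x) (2 * \<delta>) E (packing_number E \<epsilon>)"
    by (rule has_packing_mono) (use assms in auto)
  then show ?thesis
    using le_packing_number_iff[of E \<delta>] assms by simp
qed

subsection \<open>Minkowski dimensions along dyadic scales\<close>

text \<open>Common form of the comparisons between continuous scales and dyadic ones, in both
  directions: a change of variable \<open>u\<close> with an additive error that vanishes in the
  limit. The gap between \<open>z\<close> and \<open>w\<close> leaves room for the error.\<close>

lemma Limsup_ereal_le_compose:
  fixes g e :: "'a \<Rightarrow> real" and a :: "'b \<Rightarrow> real"
  assumes le: "eventually (\<lambda>x. g x \<le> a (u x) + e x) F"
    and u: "filterlim u G F" and e: "(e \<longlongrightarrow> 0) F"
  shows "Limsup F (\<lambda>x. ereal (g x)) \<le> Limsup G (\<lambda>x. ereal (a x))"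
  unfolding Limsup_le_iff
proof (intro allI impI)
  fix y assume "Limsup G (\<lambda>x. ereal (a x)) < y"
  then obtain z where z: "Limsup G (\<lambda>x. ereal (a x)) < ereal z" "ereal z < y"
    using ereal_dense2 by blast
  then obtain w where w: "ereal z < ereal w" "ereal w < y"
    using ereal_dense2 by blast
  have "eventually (\<lambda>x. a x < z) G"
    using Limsup_lessD[OF z(1)] by simp
  then have "eventually (\<lambda>x. a (u x) < z) F"
    using u by (rule eventually_compose_filterlim)
  moreover have "eventually (\<lambda>x. e x < w - z) F"
    by (rule order_tendstoD(2)[OF e]) (use w in simp)
  ultimately have "eventually (\<lambda>x. g x < w) F"
    using le by eventually_elim simp
  then show "eventually (\<lambda>x. ereal (g x) < y) F"
    by eventually_elim (use w(2) in \<open>simp add: less_trans[of "ereal _" "ereal w"]\<close>)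
qed

lemma Liminf_ereal_le_compose:
  fixes g e :: "'a \<Rightarrow> real" and a :: "'b \<Rightarrow> real"
  assumes "eventually (\<lambda>x. a (u x) \<le> g x + e x) F"
    and "filterlim u G F" and "(e \<longlongrightarrow> 0) F"
  shows "Liminf G (\<lambda>x. ereal (a x)) \<le> Liminf F (\<lambda>x. ereal (g x))"
proof -
  have "eventually (\<lambda>x. - g x \<le> - a (u x) + e x) F"
    using assms(1) by eventually_elim simp
  from Limsup_ereal_le_compose[of "\<lambda>x. - g x" "\<lambda>x. - a x", OF this assms(2,3)]
  have "Limsup F (\<lambda>x. - ereal (g x)) \<le> Limsup G (\<lambda>x. - ereal (a x))"
    unfolding uminus_ereal.simps(1) .
  then show ?thesis
    unfolding ereal_Limsup_uminus by simp
qed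

lemma Liminf_Limsup_real_between:
  fixes a :: "nat \<Rightarrow> real"
  assumes "eventually (\<lambda>k. 0 \<le> a k \<and> a k \<le> K) sequentially"
  shows "\<exists>c1 c2. liminf (\<lambda>k. ereal (a k)) = ereal c1 \<and> limsup (\<lambda>k. ereal (a k)) = ereal c2"
proof -
  have "0 \<le> liminf (\<lambda>k. ereal (a k))"
    by (rule Liminf_bounded) (use assms in eventually_elim, simp)
  moreover have "liminf (\<lambda>k. ereal (a k)) \<le> limsup (\<lambda>k. ereal (a k))"
    by (rule Liminf_le_Limsup) simp
  moreover have "limsup (\<lambda>k. ereal (a k)) \<le> ereal K"
    by (rule Limsup_bounded) (use assms in eventually_elim, simp)
  ultimately show ?thesis
    by (cases "liminf (\<lambda>k. ereal (a k))"; cases "limsup (\<lambda>k. ereal (a k))") auto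
qed

text \<open>Polynomial factors and bounded index shifts change the logarithm by O(log k), which
  disappears after division by k. The factor in \<open>upper\<close> is 2 (j + 2)^3 at j =
  \<open>Suc k\<close>.\<close>

lemma minkowski_dim_eq_sequence:
  fixes E :: "'a::euclidean_space set" and N :: "nat \<Rightarrow> nat"
  defines "a \<equiv> \<lambda>k. ln (real (N k)) / (real k * ln 2)"
  assumes "bounded E"
    and lower: "eventually (\<lambda>k. 1 \<le> N k \<and> N k \<le> packing_number E ((1/2) ^ k)) sequentially"
    and upper: "eventually (\<lambda>k. packing_number E ((1/2) ^ k) \<le> 2 * (k + 3) ^ 3 * N (Suc k)) sequentially"
  shows "lower_minkowski_dim E = liminf (\<lambda>k. ereal (a k))"
    and "upper_minkowski_dim E = limsup (\<lambda>k. ereal (a k))"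
    and "\<exists>K. eventually (\<lambda>k. 0 \<le> a k \<and> a k \<le> K) sequentially"
proof -
  define p where "p \<epsilon> = real (packing_number E \<epsilon>)" for \<epsilon>
  define g where "g \<epsilon> = ln (p \<epsilon>) / ln (inverse \<epsilon>)" for \<epsilon>
  have g_half: "g ((1/2) ^ k) = ln (p ((1/2) ^ k)) / (real k * ln 2)" for k
    by (simp add: g_def ln_realpow power_one_over flip: power_inverse)
  obtain C where C: "0 < C" "\<And>\<epsilon> m. 0 < \<epsilon> \<Longrightarrow> \<epsilon> \<le> 1 \<Longrightarrow>
      has_packing (\<lambda>x. x) (2 * \<epsilon>) E m \<Longrightarrow> real m \<le> C / \<epsilon> ^ DIM('a)"
    using has_packing_volume_bound[OF \<open>bounded E\<close>] by blast
  have pC: "p ((1/2) ^ k) \<le> C * (2 ^ k) ^ DIM('a)" for k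
  proof -
    have "p ((1/2) ^ k) \<le> C / ((1/2) ^ k) ^ DIM('a)"
      unfolding p_def
      using le_packing_number_iff[OF \<open>bounded E\<close>, of "(1/2) ^ k" "packing_number E ((1/2) ^ k)"]
      by (intro C(2)) (auto simp: power_le_one)
    then show ?thesis
      by (simp add: power_one_over power_divide)
  qed
  \<comment> \<open>The volume bound gives exponent \<open>DIM('a)\<close> plus ln C / (k ln 2); the
    last term is estimated with k \<ge> 1.\<close>
  define K where "K = real DIM('a) + \<bar>ln C\<bar> / ln 2"
  have "0 \<le> K" by (simp add: K_def)
  have a_bounds: "eventually (\<lambda>k. 0 \<le> a k \<and> a k \<le> K) sequentially"
    using lower eventually_gt_at_top[of 0]
  proof eventually_elim
    case (elim k)
    have "real (N k) \<le> C * (2 ^ k) ^ DIM('a)"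
      using elim pC[of k] unfolding p_def by linarith
    then have "ln (real (N k)) \<le> ln (C * (2 ^ k) ^ DIM('a))"
      using elim C(1) by (intro ln_mono) auto
    also have "\<dots> = ln C + real k * real DIM('a) * ln 2"
      using C(1) by (simp add: ln_mult ln_realpow)
    also have "\<dots> \<le> \<bar>ln C\<bar> * real k + real k * real DIM('a) * ln 2"
    proof -
      have "ln C \<le> \<bar>ln C\<bar> * 1" by simp
      also have "\<dots> \<le> \<bar>ln C\<bar> * real k"
        using elim by (intro mult_left_mono) auto
      finally show ?thesis by simp
    qed
    also have "\<dots> = K * (real k * ln 2)"
      by (simp add: K_def field_simps)
    finally have "a k \<le> K"
      unfolding a_def using elim by (simp add: pos_divide_le_eq)
    moreover have "0 \<le> a k"
      unfolding a_def using elim by auto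
    ultimately show ?case by simp
  qed
  then show "\<exists>K. eventually (\<lambda>k. 0 \<le> a k \<and> a k \<le> K) sequentially" by blast
  have ln_N: "ln (real (N k)) = a k * (real k * ln 2)" if "0 < k" for k
    unfolding a_def using that by simp

  \<comment> \<open>Changing the denominator from k ln 2 to (k - 2) ln 2 leaves 2 \<open>a k\<close>
    ln 2 \<le> 2 K ln 2 over; the other term is the logarithm of the polynomial factor.\<close>
  define e where "e k = (2 * K * ln 2 + ln (2 * (real k + 2) ^ 3)) / ((real k - 2) * ln 2)" for k :: nat
  have e: "e \<longlonglongrightarrow> 0"
    unfolding e_def by real_asymp
  \<comment> \<open>Error from replacing the denominator k by k + 1: a k/(k + 1) = a - a/(k + 1),
    and 0 \<le> a \<le> K.\<close>
  define e' where "e' k = K / real k" for k :: nat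
  have e': "e' \<longlonglongrightarrow> 0"
    unfolding e'_def by real_asymp

  \<comment> \<open>The free \<open>x\<close> serves two denominators: x = k - 2 when a scale is
    rounded to a dyadic one, and x = k - 1 on the dyadic scales themselves.\<close>
  have upper_step: "eventually (\<lambda>k. \<forall>x. real k - 2 \<le> x \<longrightarrow>
      ln (p ((1/2) ^ (k - 1))) / (x * ln 2) \<le> a k + e k) sequentially"
  proof -
    have "eventually (\<lambda>k. p ((1/2) ^ (k - 1)) \<le> 2 * (real k + 2) ^ 3 * N k \<and> 1 \<le> p ((1/2) ^ (k - 1)))
        sequentially"
    proof -
      have "eventually (\<lambda>k. p ((1/2) ^ k) \<le> 2 * (real (Suc k) + 2) ^ 3 * N (Suc k) \<and>
          1 \<le> p ((1/2) ^ k)) sequentially"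
        using upper lower
      proof eventually_elim
        case (elim k)
        have "real (packing_number E ((1/2) ^ k)) \<le> real (2 * (k + 3) ^ 3 * N (Suc k))"
          using elim(1) by (simp only: of_nat_le_iff)
        also have "\<dots> = 2 * (real (Suc k) + 2) ^ 3 * N (Suc k)"
          by (simp add: add_ac)
        finally show ?case
          using elim(2) unfolding p_def by simp
      qed
      then show ?thesis
        by (subst eventually_sequentially_Suc[symmetric]) simp
    qed
    then show ?thesis
      using lower a_bounds eventually_gt_at_top[of 2]
    proof eventually_elim
      case (elim k)
      have "ln (p ((1/2) ^ (k - 1))) \<le> ln (2 * (real k + 2) ^ 3 * N k)"
        using elim by (intro ln_mono) auto
      also have "\<dots> = a k * (real k * ln 2) + ln (2 * (real k + 2) ^ 3)"
        using elim ln_N[of k] by (simp add: ln_mult)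
      also have "\<dots> \<le> a k * ((real k - 2) * ln 2) + (2 * K * ln 2 + ln (2 * (real k + 2) ^ 3))"
      proof -
        have "a k * ln 2 \<le> K * ln 2"
          using elim by (intro mult_right_mono) auto
        then show ?thesis by (simp add: algebra_simps)
      qed
      also have "\<dots> = (a k + e k) * ((real k - 2) * ln 2)"
        using elim by (simp add: e_def field_simps)
      finally have main: "ln (p ((1/2) ^ (k - 1))) / ((real k - 2) * ln 2) \<le> a k + e k"
        using elim by (subst pos_divide_le_eq) auto
      show ?case
      proof (intro allI impI)
        fix x assume x: "real k - 2 \<le> x"
        have "ln (p ((1/2) ^ (k - 1))) / (x * ln 2) \<le> ln (p ((1/2) ^ (k - 1))) / ((real k - 2) * ln 2)"
          using elim x by (intro divide_left_mono mult_right_mono mult_pos_pos) auto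
        with main show "ln (p ((1/2) ^ (k - 1))) / (x * ln 2) \<le> a k + e k"
          by linarith
      qed
    qed
  qed

  \<comment> \<open>The dyadic index of a scale: 2^-(u + 1) \<le> \<epsilon> \<le> 2^-u.\<close>
  define u where "u \<epsilon> = nat \<lfloor>ln (inverse \<epsilon>) / ln 2\<rfloor>" for \<epsilon> :: real
  have u_lim: "filterlim u sequentially (at_right 0)"
  proof -
    have "filterlim (\<lambda>\<epsilon>::real. ln (inverse \<epsilon>) / ln 2) at_top (at_right 0)"
      by real_asymp
    then show ?thesis
      unfolding u_def
      by (intro filterlim_compose[OF filterlim_nat_sequentially]
          filterlim_compose[OF filterlim_floor_sequentially])
  qed
  have u: "real (u \<epsilon>) * ln 2 \<le> ln (inverse \<epsilon>)" "ln (inverse \<epsilon>) \<le> (real (u \<epsilon>) + 1) * ln 2"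
    "(1/2) ^ (u \<epsilon> + 1) \<le> \<epsilon>" "\<epsilon> \<le> (1/2) ^ u \<epsilon>" if "0 < \<epsilon>" "\<epsilon> < 1" for \<epsilon>
  proof -
    have "0 \<le> ln (inverse \<epsilon>) / ln 2"
      using that by (intro divide_nonneg_pos ln_ge_zero) (simp_all add: one_le_inverse)
    then have *: "real (u \<epsilon>) \<le> ln (inverse \<epsilon>) / ln 2" "ln (inverse \<epsilon>) / ln 2 \<le> real (u \<epsilon>) + 1"
      unfolding u_def by linarith+
    then show 1: "real (u \<epsilon>) * ln 2 \<le> ln (inverse \<epsilon>)"
      and 2: "ln (inverse \<epsilon>) \<le> (real (u \<epsilon>) + 1) * ln 2"
      by (simp_all add: field_simps)
    have ln_half: "ln ((1/2) ^ k) = - (real k * ln 2)" for k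
      by (simp add: ln_realpow ln_div)
    have "ln ((1/2) ^ (u \<epsilon> + 1)) \<le> ln \<epsilon>"
      using 2 that unfolding ln_half by (simp add: ln_inverse algebra_simps)
    then show "(1/2) ^ (u \<epsilon> + 1) \<le> \<epsilon>"
      using that by (subst (asm) ln_le_cancel_iff) auto
    have "ln \<epsilon> \<le> ln ((1/2) ^ u \<epsilon>)"
      using 1 that unfolding ln_half by (simp add: ln_inverse)
    then show "\<epsilon> \<le> (1/2) ^ u \<epsilon>"
      using that by (subst (asm) ln_le_cancel_iff) auto
  qed
  have small: "eventually (\<lambda>\<epsilon>::real. 0 < \<epsilon> \<and> \<epsilon> < 1) (at_right 0)"
    using eventually_at_right_real[of 0 "1::real"] by (auto elim: eventually_mono)

  have lower_dim: "lower_minkowski_dim E = Liminf (at_right 0) (\<lambda>\<epsilon>. ereal (g \<epsilon>))"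
    and upper_dim: "upper_minkowski_dim E = Limsup (at_right 0) (\<lambda>\<epsilon>. ereal (g \<epsilon>))"
    by (simp_all add: lower_minkowski_dim_def upper_minkowski_dim_def g_def p_def)
  have half_lim: "filterlim (\<lambda>k. (1/2::real) ^ k) (at_right 0) sequentially"
    by real_asymp

  have "Limsup (at_right 0) (\<lambda>\<epsilon>. ereal (g \<epsilon>)) \<le> limsup (\<lambda>k. ereal (a k))"
  \<comment> \<open>The shift by 2 has two sources: rounding \<epsilon> down to 2^-(u + 1), and the
    index \<open>Suc k\<close> in \<open>upper\<close>.\<close>
  proof (rule Limsup_ereal_le_compose[where u = "\<lambda>\<epsilon>. u \<epsilon> + 2" and e = "\<lambda>\<epsilon>. e (u \<epsilon> + 2)"])
    show lim: "filterlim (\<lambda>\<epsilon>. u \<epsilon> + 2) sequentially (at_right 0)"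
      using u_lim by (rule filterlim_compose[OF filterlim_add_const_nat_at_top])
    show "\<forall>\<^sub>F \<epsilon> in at_right 0. g \<epsilon> \<le> a (u \<epsilon> + 2) + e (u \<epsilon> + 2)"
      using small eventually_compose_filterlim[OF upper_step lim]
        eventually_compose_filterlim[OF lower u_lim] eventually_compose_filterlim[OF eventually_gt_at_top[of 0] u_lim]
    proof eventually_elim
      case (elim \<epsilon>)
      have "p \<epsilon> \<le> p ((1/2) ^ (u \<epsilon> + 1))"
        unfolding p_def using packing_number_antimono[OF \<open>bounded E\<close> _ u(3)[of \<epsilon>]] elim by simp
      \<comment> \<open>The logarithm must be nonnegative, since the quotient is enlarged by
        lowering its denominator.\<close>
      moreover have "p ((1/2) ^ u \<epsilon>) \<le> p \<epsilon>"
        unfolding p_def using packing_number_antimono[OF \<open>bounded E\<close> _ u(4)[of \<epsilon>]] elim by simp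
      moreover have "1 \<le> p ((1/2) ^ u \<epsilon>)"
        unfolding p_def using elim by linarith
      ultimately have "0 \<le> ln (p \<epsilon>)" "ln (p \<epsilon>) \<le> ln (p ((1/2) ^ (u \<epsilon> + 1)))"
        by (auto intro!: ln_mono)
      then have "g \<epsilon> \<le> ln (p ((1/2) ^ (u \<epsilon> + 1))) / (real (u \<epsilon>) * ln 2)"
        unfolding g_def using u(1)[of \<epsilon>] elim by (intro frac_le) auto
      also have "\<dots> \<le> a (u \<epsilon> + 2) + e (u \<epsilon> + 2)"
        using elim(2)[rule_format, of "real (u \<epsilon>)"] by simp
      finally show ?case .
    qed
    show "((\<lambda>\<epsilon>. e (u \<epsilon> + 2)) \<longlongrightarrow> 0) (at_right 0)"
      using e lim by (rule filterlim_compose)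
  qed
  moreover have "limsup (\<lambda>k. ereal (a k)) \<le> Limsup (at_right 0) (\<lambda>\<epsilon>. ereal (g \<epsilon>))"
  proof (rule Limsup_ereal_le_compose[where u = "\<lambda>k. (1/2) ^ k" and e = "\<lambda>_. 0"])
    show "\<forall>\<^sub>F k in sequentially. a k \<le> g ((1/2) ^ k) + 0"
      using lower
    proof eventually_elim
      case (elim k)
      then have "ln (real (N k)) \<le> ln (p ((1/2) ^ k))"
        unfolding p_def by (intro ln_mono) auto
      then show ?case
        unfolding g_half a_def by (simp add: divide_right_mono)
    qed
  qed (simp_all add: half_lim)
  ultimately show "upper_minkowski_dim E = limsup (\<lambda>k. ereal (a k))"
    unfolding upper_dim by (rule antisym)

  have "Liminf (at_right 0) (\<lambda>\<epsilon>. ereal (g \<epsilon>)) \<le> liminf (\<lambda>k. ereal (a k))"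
  \<comment> \<open>\<open>N k\<close> controls the packing number from above at scale 2^-(k - 1),
    so the dimension is tested along these scales.\<close>
  proof (rule Liminf_ereal_le_compose[where u = "\<lambda>k. (1/2) ^ (k - 1)" and e = e])
    show "filterlim (\<lambda>k. (1/2::real) ^ (k - 1)) (at_right 0) sequentially"
      by (rule filterlim_compose[OF half_lim filterlim_minus_const_nat_at_top])
    show "\<forall>\<^sub>F k in sequentially. g ((1/2) ^ (k - 1)) \<le> a k + e k"
      using upper_step eventually_gt_at_top[of 0]
    proof eventually_elim
      case (elim k)
      then show ?case
        using elim(1)[rule_format, of "real (k - 1)"] unfolding g_half by simp
    qed
  qed (rule e)
  moreover have "liminf (\<lambda>k. ereal (a k)) \<le> Liminf (at_right 0) (\<lambda>\<epsilon>. ereal (g \<epsilon>))"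
  proof (rule Liminf_ereal_le_compose[where u = u and e = "\<lambda>\<epsilon>. e' (u \<epsilon>)"])
    show "\<forall>\<^sub>F \<epsilon> in at_right 0. a (u \<epsilon>) \<le> g \<epsilon> + e' (u \<epsilon>)"
      using small eventually_compose_filterlim[OF lower u_lim]
        eventually_compose_filterlim[OF a_bounds u_lim]
        eventually_compose_filterlim[OF eventually_gt_at_top[of 0] u_lim]
    proof eventually_elim
      case (elim \<epsilon>)
      have "p ((1/2) ^ u \<epsilon>) \<le> p \<epsilon>"
        unfolding p_def using packing_number_antimono[OF \<open>bounded E\<close> _ u(4)[of \<epsilon>]] elim by simp
      moreover have "real (N (u \<epsilon>)) \<le> p ((1/2) ^ u \<epsilon>)"
        unfolding p_def using elim by simp
      ultimately have "ln (real (N (u \<epsilon>))) \<le> ln (p \<epsilon>)"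
        using elim by (intro ln_mono) auto
      moreover have "0 \<le> ln (real (N (u \<epsilon>)))"
        using elim by simp
      moreover have "0 < real (u \<epsilon>) * ln 2"
        using elim by simp
      then have "0 < ln (inverse \<epsilon>)"
        using u(1)[of \<epsilon>] elim by linarith
      ultimately have "ln (real (N (u \<epsilon>))) / ((real (u \<epsilon>) + 1) * ln 2) \<le> g \<epsilon>"
        unfolding g_def using u(2)[of \<epsilon>] elim by (intro frac_le) linarith+
      moreover have "a (u \<epsilon>) - e' (u \<epsilon>) \<le> ln (real (N (u \<epsilon>))) / ((real (u \<epsilon>) + 1) * ln 2)"
      proof -
        have "a (u \<epsilon>) / (real (u \<epsilon>) + 1) \<le> K / real (u \<epsilon>)"
          using elim \<open>0 \<le> K\<close> by (intro frac_le) auto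
        moreover have "ln (real (N (u \<epsilon>))) / ((real (u \<epsilon>) + 1) * ln 2) =
            a (u \<epsilon>) * real (u \<epsilon>) / (real (u \<epsilon>) + 1)"
          using elim by (simp add: ln_N)
        moreover have "\<dots> = a (u \<epsilon>) - a (u \<epsilon>) / (real (u \<epsilon>) + 1)"
          by (simp add: field_simps)
        ultimately show ?thesis
          unfolding e'_def by linarith
      qed
      ultimately show ?case by linarith
    qed
    show "((\<lambda>\<epsilon>. e' (u \<epsilon>)) \<longlongrightarrow> 0) (at_right 0)"
      using e' u_lim by (rule filterlim_compose)
  qed (rule u_lim)
  ultimately show "lower_minkowski_dim E = liminf (\<lambda>k. ereal (a k))"
    unfolding lower_dim by (rule antisym)
qed

subsection \<open>Packing numbers of processes with independent increments\<close>

text \<open>A countable index set has only countably many finite subsets, so the event is a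
  countable union of finite intersections of measurable conditions.\<close>

lemma has_packing_measurable:
  fixes X :: "'i \<Rightarrow> 'w \<Rightarrow> 'a::euclidean_space"
  assumes "countable I" and [measurable]: "\<And>i. i \<in> I \<Longrightarrow> X i \<in> borel_measurable M"
  shows "Measurable.pred M (\<lambda>\<omega>. has_packing (\<lambda>i. X i \<omega>) r I m)"
proof -
  let ?F = "{T. finite T \<and> T \<subseteq> I \<and> card T = m}"
  have "countable ?F"
    by (rule countable_subset[OF _ countable_Collect_finite_subset[OF assms(1)]]) auto
  have T: "Measurable.pred M (\<lambda>\<omega>. \<forall>i\<in>T. \<forall>j\<in>T. i \<noteq> j \<longrightarrow> r \<le> dist (X i \<omega>) (X j \<omega>))"
    if "T \<in> ?F" for T
  proof -
    have [measurable]: "X i \<in> borel_measurable M" if "i \<in> T" for i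
      using that \<open>T \<in> ?F\<close> assms(2) by blast
    show ?thesis
      by (intro pred_intros_finite(3)) (use that in \<open>auto intro!: pred_intros_logic\<close>)
  qed
  have "Measurable.pred M (\<lambda>\<omega>. \<exists>T\<in>?F. \<forall>i\<in>T. \<forall>j\<in>T. i \<noteq> j \<longrightarrow> r \<le> dist (X i \<omega>) (X j \<omega>))"
    using T \<open>countable ?F\<close> unfolding pred_def by (intro sets.sets_Collect_countable_Ex') auto
  then show ?thesis
    unfolding has_packing_def by (simp add: Bex_def conj_assoc)
qed

text \<open>First passage at \<open>i\<close> is determined by the increments with index below
  \<open>i\<close>, and a packing inside \<open>{i<..n}\<close> by those strictly between
  \<open>i\<close> and \<open>n\<close>, since only differences of positions count. The two groups
  are disjoint, the step from \<open>i\<close> to \<open>Suc i\<close> belonging to neither, so the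
  events are independent.\<close>

lemma (in prob_space) has_packing_submultiplicative:
  fixes X :: "nat \<Rightarrow> 'a \<Rightarrow> 'b::euclidean_space"
  assumes indep: "indep_vars (\<lambda>_. borel) (\<lambda>i \<omega>. X (Suc i) \<omega> - X i \<omega>) {..<n}"
    and X: "\<And>i. i \<le> n \<Longrightarrow> random_variable borel (X i)"
    and "0 < m"
  shows "prob {\<omega>\<in>space M. has_packing (\<lambda>i. X i \<omega>) r {..n} (m + l)} \<le>
    prob {\<omega>\<in>space M. has_packing (\<lambda>i. X i \<omega>) r {..n} m} *
    prob {\<omega>\<in>space M. has_packing (\<lambda>i. X i \<omega>) r {..n} l}"
proof -
  define D where "D i \<omega> = X (Suc i) \<omega> - X i \<omega>" for i \<omega>
  define first where "first i y \<longleftrightarrow> has_packing y r {..i} m \<and> \<not> has_packing y r {..<i} m"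
    for i and y :: "nat \<Rightarrow> 'b"
  define E where "E i = {\<omega>\<in>space M. first i (\<lambda>i. X i \<omega>)}" for i
  define G where "G i = {\<omega>\<in>space M. has_packing (\<lambda>i. X i \<omega>) r {i<..n} l}" for i
  have meas: "{\<omega>\<in>space M. has_packing (\<lambda>i. X i \<omega>) r I k} \<in> events" if "I \<subseteq> {..n}" for I k
    using that has_packing_measurable[of I X M r k] X by (auto simp: pred_def subset_iff)
  have E_ev: "E i \<in> events" if "i \<le> n" for i
  proof -
    have "E i = {\<omega>\<in>space M. has_packing (\<lambda>i. X i \<omega>) r {..i} m} -
        {\<omega>\<in>space M. has_packing (\<lambda>i. X i \<omega>) r {..<i} m}"
      unfolding E_def first_def by auto
    then show ?thesis using that by (auto intro!: sets.Diff meas)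
  qed
  have G_ev: "G i \<in> events" for i
    unfolding G_def by (rule meas) auto
  have tele: "(\<Sum>k=a..<b. D k \<omega>) = X b \<omega> - X a \<omega>" if "a \<le> b" for a b \<omega>
    unfolding D_def by (rule sum_Suc_diff'[OF that])
  have EG: "prob (E i \<inter> G i) = prob (E i) * prob (G i)" if i: "i \<le> n" for i
  proof -
    let ?N1 = "PiM {..<i} (\<lambda>_. borel :: 'b measure)" and ?N2 = "PiM {i<..<n} (\<lambda>_. borel :: 'b measure)"
    \<comment> \<open>Both events are rewritten as events about increments: the path is rebuilt from
      partial sums, recentered at \<open>X 0\<close> for the past and at \<open>X (Suc i)\<close>
      for the future.\<close>
    let ?U = "{x\<in>space ?N1. first i (\<lambda>a. \<Sum>k=0..<a. x k)}"
    let ?V = "{x\<in>space ?N2. has_packing (\<lambda>a. \<Sum>k=Suc i..<a. x k) r {i<..n} l}"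
    have m1: "(\<lambda>x. \<Sum>k=0..<a. x k) \<in> borel_measurable ?N1" if "a \<le> i" for a
      using that by (intro borel_measurable_sum measurable_component_singleton) auto
    have m2: "(\<lambda>x. \<Sum>k=Suc i..<a. x k) \<in> borel_measurable ?N2" if "a \<le> n" for a
      using that by (intro borel_measurable_sum measurable_component_singleton) auto
    have U: "?U \<in> sets ?N1"
      unfolding first_def pred_def[symmetric]
      by (intro pred_intros_logic has_packing_measurable m1) auto
    have V: "?V \<in> sets ?N2"
      unfolding pred_def[symmetric] by (intro has_packing_measurable m2) auto
    have packD: "has_packing (\<lambda>a. \<Sum>k=0..<a. restrict (\<lambda>k. D k \<omega>) {..<i} k) r I k \<longleftrightarrow>
        has_packing (\<lambda>a. X a \<omega>) r I k" if "I \<subseteq> {..i}" for I k \<omega>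
    proof (rule has_packing_cong)
      have eq: "(\<Sum>k=0..<a. restrict (\<lambda>k. D k \<omega>) {..<i} k) = X a \<omega> - X 0 \<omega>" if "a \<in> I" for a
        unfolding tele[of 0 a, symmetric, OF le0]
        by (intro sum.cong) (use that \<open>I \<subseteq> {..i}\<close> in \<open>auto simp: subset_iff\<close>)
      show "dist (\<Sum>k=0..<a. restrict (\<lambda>k. D k \<omega>) {..<i} k) (\<Sum>k=0..<b. restrict (\<lambda>k. D k \<omega>) {..<i} k) =
          dist (X a \<omega>) (X b \<omega>)" if "a \<in> I" "b \<in> I" for a b
        unfolding eq[OF that(1)] eq[OF that(2)] by (simp add: dist_norm)
    qed
    have sub: "{..<i} \<subseteq> {..i}" by auto
    have EU: "E i = (\<lambda>\<omega>. restrict (\<lambda>k. D k \<omega>) {..<i}) -` ?U \<inter> space M"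
      using packD[of "{..i}", OF order_refl] packD[of "{..<i}", OF sub]
      unfolding E_def first_def by (auto simp: space_PiM simp del: restrict_apply)
    have "has_packing (\<lambda>a. \<Sum>k=Suc i..<a. restrict (\<lambda>k. D k \<omega>) {i<..<n} k) r {i<..n} l \<longleftrightarrow>
        has_packing (\<lambda>a. X a \<omega>) r {i<..n} l" for \<omega>
    proof (rule has_packing_cong)
      have eq: "(\<Sum>k=Suc i..<a. restrict (\<lambda>k. D k \<omega>) {i<..<n} k) = X a \<omega> - X (Suc i) \<omega>"
        if "a \<in> {i<..n}" for a
      proof -
        have "(\<Sum>k=Suc i..<a. restrict (\<lambda>k. D k \<omega>) {i<..<n} k) = (\<Sum>k=Suc i..<a. D k \<omega>)"
          by (intro sum.cong) (use that in auto)
        also have "\<dots> = X a \<omega> - X (Suc i) \<omega>"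
          by (rule tele) (use that in auto)
        finally show ?thesis .
      qed
      show "dist (\<Sum>k=Suc i..<a. restrict (\<lambda>k. D k \<omega>) {i<..<n} k)
          (\<Sum>k=Suc i..<b. restrict (\<lambda>k. D k \<omega>) {i<..<n} k) = dist (X a \<omega>) (X b \<omega>)"
        if "a \<in> {i<..n}" "b \<in> {i<..n}" for a b
        unfolding eq[OF that(1)] eq[OF that(2)] by (simp add: dist_norm)
    qed
    then have GV: "G i = (\<lambda>\<omega>. restrict (\<lambda>k. D k \<omega>) {i<..<n}) -` ?V \<inter> space M"
      unfolding G_def by (auto simp: space_PiM simp del: restrict_apply)
    have "indep_var ?N1 (\<lambda>\<omega>. restrict (\<lambda>k. D k \<omega>) {..<i}) ?N2 (\<lambda>\<omega>. restrict (\<lambda>k. D k \<omega>) {i<..<n})"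
      by (rule indep_var_restrict) (use indep i in \<open>auto simp: D_def\<close>)
    note indep_varD[OF this U V]
    moreover have "(\<lambda>\<omega>. (restrict (\<lambda>k. D k \<omega>) {..<i}, restrict (\<lambda>k. D k \<omega>) {i<..<n})) -` (?U \<times> ?V)
        \<inter> space M = E i \<inter> G i"
      unfolding EU GV by blast
    ultimately show ?thesis
      unfolding EU GV by simp
  qed
  have disj: "disjoint_family_on E {..n}"
    unfolding disjoint_family_on_def
  proof (intro ballI impI)
    have "E i \<inter> E j = {}" if "i < j" for i j
    proof -
      have "has_packing (\<lambda>i. X i \<omega>) r {..<j} m" if "has_packing (\<lambda>i. X i \<omega>) r {..i} m" for \<omega>
        using that by (rule has_packing_mono) (use \<open>i < j\<close> in auto)
      then show ?thesis unfolding E_def first_def by auto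
    qed
    then show "E i \<inter> E j = {}" if "i \<noteq> j" for i j
      using that by (metis Int_commute linorder_neqE_nat)
  qed
  have "prob {\<omega>\<in>space M. has_packing (\<lambda>i. X i \<omega>) r {..n} (m + l)} \<le> prob (\<Union>i\<in>{..n}. E i \<inter> G i)"
  proof (rule finite_measure_mono)
    show "{\<omega>\<in>space M. has_packing (\<lambda>i. X i \<omega>) r {..n} (m + l)} \<subseteq> (\<Union>i\<in>{..n}. E i \<inter> G i)"
    proof
      fix \<omega> assume \<omega>: "\<omega> \<in> {\<omega>\<in>space M. has_packing (\<lambda>i. X i \<omega>) r {..n} (m + l)}"
      then obtain i where "i \<le> n" "has_packing (\<lambda>i. X i \<omega>) r {..i} m"
          "\<not> has_packing (\<lambda>i. X i \<omega>) r {..<i} m" "has_packing (\<lambda>i. X i \<omega>) r {i<..n} l"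
        using has_packing_first_passage[OF _ assms(3)] by blast
      with \<omega> show "\<omega> \<in> (\<Union>i\<in>{..n}. E i \<inter> G i)"
        unfolding E_def G_def first_def by auto
    qed
  qed (use E_ev G_ev in auto)
  also have "\<dots> \<le> (\<Sum>i\<le>n. prob (E i \<inter> G i))"
    by (rule finite_measure_subadditive_finite) (use E_ev G_ev in auto)
  also have "\<dots> = (\<Sum>i\<le>n. prob (E i) * prob (G i))"
    by (intro sum.cong) (auto simp: EG)
  \<comment> \<open>Enlarging \<open>G i\<close> to the packing event of the full range makes the
    second factor independent of \<open>i\<close>; the disjoint \<open>E i\<close> can then be
    summed.\<close>
  also have "\<dots> \<le> (\<Sum>i\<le>n. prob (E i) * prob {\<omega>\<in>space M. has_packing (\<lambda>i. X i \<omega>) r {..n} l})"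
  proof (intro sum_mono mult_left_mono finite_measure_mono meas)
    have "has_packing (\<lambda>i. X i \<omega>) r {..n} l" if "has_packing (\<lambda>i. X i \<omega>) r {i<..n} l" for i \<omega>
      using that by (rule has_packing_mono) auto
    then show "G i \<subseteq> {\<omega>\<in>space M. has_packing (\<lambda>i. X i \<omega>) r {..n} l}" for i
      unfolding G_def by blast
  qed auto
  also have "\<dots> = prob (\<Union>i\<in>{..n}. E i) * prob {\<omega>\<in>space M. has_packing (\<lambda>i. X i \<omega>) r {..n} l}"
    unfolding sum_distrib_right[symmetric]
    by (subst finite_measure_finite_Union) (use E_ev disj in auto)
  also have "\<dots> \<le> prob {\<omega>\<in>space M. has_packing (\<lambda>i. X i \<omega>) r {..n} m} *
      prob {\<omega>\<in>space M. has_packing (\<lambda>i. X i \<omega>) r {..n} l}"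
  proof (intro mult_right_mono finite_measure_mono meas)
    show "(\<Union>i\<in>{..n}. E i) \<subseteq> {\<omega>\<in>space M. has_packing (\<lambda>i. X i \<omega>) r {..n} m}"
    proof
      fix \<omega> assume "\<omega> \<in> (\<Union>i\<in>{..n}. E i)"
      then obtain i where i: "i \<le> n" "\<omega> \<in> space M" "has_packing (\<lambda>i. X i \<omega>) r {..i} m"
        unfolding E_def first_def by auto
      have "has_packing (\<lambda>i. X i \<omega>) r {..n} m"
        using i(3) by (rule has_packing_mono) (use i(1) in auto)
      with i(2) show "\<omega> \<in> {\<omega>\<in>space M. has_packing (\<lambda>i. X i \<omega>) r {..n} m}"
        by simp
    qed
  qed auto
  finally show ?thesis .
qed

section \<open>Submultiplicativity for \<open>B + f\<close>, and concentration as its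
  consequence\<close>

context standard_brownian_motion
begin

lemma has_packing_events:
  fixes f :: "real \<Rightarrow> 'a"
  assumes "countable A" "A \<subseteq> {0..}"
  shows "{\<omega>\<in>space M. has_packing (\<lambda>t. B t \<omega> + f t) r A m} \<in> events"
  unfolding pred_def[symmetric]
proof (rule has_packing_measurable[OF assms(1)])
  fix t assume "t \<in> A"
  then have "random_variable borel (B t)"
    using assms(2) by (intro measurable_B) auto
  then show "random_variable borel (\<lambda>\<omega>. B t \<omega> + f t)"
    by simp
qed

text \<open>Listing \<open>F\<close> in increasing order turns it into consecutive times, and the
  values of \<open>f\<close> add a constant to each increment, which preserves independence. The
  case m = 0, where there is no first passage, is trivial.\<close>

lemma has_packing_submultiplicative_finite:
  fixes f :: "real \<Rightarrow> 'a"
  assumes "finite F" "F \<subseteq> {0..}"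
  shows "prob {\<omega>\<in>space M. has_packing (\<lambda>t. B t \<omega> + f t) r F (m + l)} \<le>
    prob {\<omega>\<in>space M. has_packing (\<lambda>t. B t \<omega> + f t) r F m} *
    prob {\<omega>\<in>space M. has_packing (\<lambda>t. B t \<omega> + f t) r F l}"
proof (cases "m = 0 \<or> F = {}")
  case True
  then show ?thesis
    by (cases "m = 0"; cases "l = 0") (auto simp: prob_space)
next
  case False
  define \<tau> where "\<tau> i = sorted_list_of_set F ! i" for i
  define n where "n = card F - 1"
  have card: "card F = Suc n"
    using False assms(1) by (simp add: n_def card_gt_0_iff)
  have less: "\<tau> i < \<tau> j" if "i < j" "j \<le> n" for i j
    unfolding \<tau>_def using that card
    by (intro sorted_wrt_nth_less[OF strict_sorted_list_of_set]) auto
  then have inj: "inj_on \<tau> {..n}"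
    by (intro linorder_inj_onI) (auto dest: less)
  have "F = set (sorted_list_of_set F)"
    using assms(1) by simp
  also have "\<dots> = \<tau> ` {..n}"
    unfolding set_conv_nth \<tau>_def using card by (auto simp: less_Suc_eq_le)
  finally have F: "F = \<tau> ` {..n}" .
  have nonneg: "0 \<le> \<tau> i" if "i \<le> n" for i
    using that assms(2) unfolding F by auto
  define X where "X i \<omega> = B (\<tau> i) \<omega> + f (\<tau> i)" for i \<omega>
  have "indep_vars (\<lambda>_. borel) (\<lambda>i \<omega>. B (\<tau> (Suc i)) \<omega> - B (\<tau> i) \<omega>) {..<n}"
    by (intro indep_increments_B nonneg less) auto
  then have "indep_vars (\<lambda>_. borel)
      (\<lambda>i \<omega>. (B (\<tau> (Suc i)) \<omega> - B (\<tau> i) \<omega>) + (f (\<tau> (Suc i)) - f (\<tau> i))) {..<n}"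
    by (rule indep_vars_compose2) simp
  then have "indep_vars (\<lambda>_. borel) (\<lambda>i \<omega>. X (Suc i) \<omega> - X i \<omega>) {..<n}"
    by (simp add: X_def algebra_simps)
  moreover have "random_variable borel (X i)" if "i \<le> n" for i
    using measurable_B[OF nonneg[OF that]] unfolding X_def by simp
  moreover have "has_packing (\<lambda>t. B t \<omega> + f t) r F k \<longleftrightarrow> has_packing (\<lambda>i. X i \<omega>) r {..n} k" for k \<omega>
    unfolding F X_def by (rule has_packing_comp[OF inj, symmetric])
  ultimately show ?thesis
    using has_packing_submultiplicative[of X n m r l] False by simp
qed

text \<open>A packing is finite, so the event for \<open>A\<close> is the increasing union of the
  events for finite subsets \<open>F n\<close> exhausting \<open>A\<close>; continuity from below
  carries the inequality over.\<close>

lemma has_packing_submultiplicative_countable: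
  fixes f :: "real \<Rightarrow> 'a"
  assumes "countable A" "A \<subseteq> {0..}"
  shows "prob {\<omega>\<in>space M. has_packing (\<lambda>t. B t \<omega> + f t) r A (m + l)} \<le>
    prob {\<omega>\<in>space M. has_packing (\<lambda>t. B t \<omega> + f t) r A m} *
    prob {\<omega>\<in>space M. has_packing (\<lambda>t. B t \<omega> + f t) r A l}"
proof (cases "A = {}")
  case True
  then show ?thesis
    using has_packing_submultiplicative_finite[of "{}"] by simp
next
  case False
  define F where "F n = from_nat_into A ` {..n::nat}" for n
  define H where "H S k = {\<omega>\<in>space M. has_packing (\<lambda>t. B t \<omega> + f t) r S k}" for S k
  have F: "finite (F n)" "F n \<subseteq> A" "F n \<subseteq> {0..}" for n
    using from_nat_into[OF False] assms(2) by (auto simp: F_def)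
  have H_mono: "H S k \<subseteq> H T k" if "S \<subseteq> T" for S T k
    unfolding H_def using that has_packing_mono by blast
  have H_ev: "H A k \<in> events" "H (F n) k \<in> events" for n k
    unfolding H_def
    using assms F(3) countable_finite[OF F(1)] by (intro has_packing_events; simp)+
  have "H A k \<subseteq> (\<Union>n. H (F n) k)" for k
  proof
    fix \<omega> assume \<omega>: "\<omega> \<in> H A k"
    then obtain T where T: "finite T" "T \<subseteq> A" "card T = k"
      "\<forall>i\<in>T. \<forall>j\<in>T. i \<noteq> j \<longrightarrow> r \<le> dist (B i \<omega> + f i) (B j \<omega> + f j)"
      unfolding H_def has_packing_def by blast
    have "\<forall>t\<in>T. \<exists>i. t = from_nat_into A i"
      using T(2) from_nat_into_surj[OF assms(1)] by (metis subsetD)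
    then obtain h where h: "\<And>t. t \<in> T \<Longrightarrow> t = from_nat_into A (h t)"
      by metis
    have "T \<subseteq> F (Max (h ` T))"
    proof
      fix t assume "t \<in> T"
      then show "t \<in> F (Max (h ` T))"
        unfolding F_def using T(1) h by (intro image_eqI[of _ _ "h t"]) auto
    qed
    then have "has_packing (\<lambda>t. B t \<omega> + f t) r (F (Max (h ` T))) k"
      unfolding has_packing_def using T by blast
    then show "\<omega> \<in> (\<Union>n. H (F n) k)"
      using \<omega> unfolding H_def by blast
  qed
  then have HA: "(\<Union>n. H (F n) k) = H A k" for k
    using H_mono[OF F(2)] by blast
  have "(\<lambda>n. prob (H (F n) (m + l))) \<longlonglongrightarrow> prob (\<Union>n. H (F n) (m + l))"
  proof (rule finite_Lim_measure_incseq)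
    show "incseq (\<lambda>n. H (F n) (m + l))"
      by (intro incseq_SucI H_mono) (auto simp: F_def)
  qed (use H_ev in auto)
  moreover have "prob (H (F n) (m + l)) \<le> prob (H A m) * prob (H A l)" for n
  proof -
    have "prob (H (F n) (m + l)) \<le> prob (H (F n) m) * prob (H (F n) l)"
      unfolding H_def by (intro has_packing_submultiplicative_finite F)
    also have "\<dots> \<le> prob (H A m) * prob (H A l)"
      by (intro mult_mono finite_measure_mono H_mono F H_ev) auto
    finally show ?thesis .
  qed
  ultimately have "prob (\<Union>n. H (F n) (m + l)) \<le> prob (H A m) * prob (H A l)"
    by (intro LIMSEQ_le_const2) auto
  then show ?thesis
    unfolding HA unfolding H_def .
qed

end

text \<open>\<open>G k m\<close> abstracts the event that the packing number at scale 2^-k is at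
  least \<open>m\<close>; \<open>null\<close> then says that this number is almost surely
  finite.\<close>

lemma (in prob_space) submultiplicative_concentration:
  fixes G :: "nat \<Rightarrow> nat \<Rightarrow> 'a set"
  assumes G: "\<And>k m. G k m \<in> events"
    and anti: "\<And>k m m'. m \<le> m' \<Longrightarrow> G k m' \<subseteq> G k m"
    and one: "\<And>k. G k 1 = space M"
    and null: "\<And>k. prob (\<Inter>m. G k m) = 0"
    and sub: "\<And>k m l. prob (G k (m + l)) \<le> prob (G k m) * prob (G k l)"
  obtains N :: "nat \<Rightarrow> nat" where "\<And>k. 1 \<le> N k"
    "AE \<omega> in M. eventually (\<lambda>k. \<omega> \<in> G k (N k) \<and> \<omega> \<notin> G k (2 * (k + 2) ^ 3 * N k)) sequentially"
proof -
  \<comment> \<open>Adding 2 keeps the level strictly between 0 and 1 already at k = 0; the square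
    makes the failure probabilities summable.\<close>
  define \<theta> where "\<theta> k = 1 - 1 / (real k + 2) ^ 2" for k
  have \<theta>: "0 < \<theta> k" "\<theta> k < 1" for k
  proof -
    have "1 < (real k + 2) ^ 2"
      by (intro one_less_power) auto
    then show "0 < \<theta> k" "\<theta> k < 1"
      unfolding \<theta>_def by (simp_all add: field_simps)
  qed
  have "\<exists>N\<ge>1. \<theta> k \<le> prob (G k N) \<and> prob (G k (N + 1)) < \<theta> k" for k
  proof -
    have "(\<lambda>m. prob (G k m)) \<longlonglongrightarrow> prob (\<Inter>m. G k m)"
      by (rule finite_Lim_measure_decseq) (use G anti in \<open>auto simp: decseq_def\<close>)
    then have "eventually (\<lambda>m. prob (G k m) < \<theta> k) sequentially"
      unfolding null using \<theta>(1) by (rule order_tendstoD)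
    then have ex: "\<exists>m. prob (G k m) < \<theta> k"
      by (auto simp: eventually_sequentially)
    \<comment> \<open>The quantile is the predecessor of the first \<open>m\<close> whose
      probability drops below the level. Such an \<open>m\<close> exists by \<open>null\<close>, and
      it exceeds 1 because \<open>G k 1\<close> is the whole space.\<close>
    define m where "m = (LEAST m. prob (G k m) < \<theta> k)"
    have m: "prob (G k m) < \<theta> k"
      unfolding m_def using ex by (rule LeastI_ex)
    have "m > 1"
    proof (rule ccontr)
      assume "\<not> m > 1"
      then have "space M \<subseteq> G k m"
        using anti[of m 1 k] one by simp
      then have "prob (space M) \<le> prob (G k m)"
        by (rule finite_measure_mono) (rule G)
      with m \<theta>(2)[of k] show False
        by (simp add: prob_space)
    qed
    moreover have "\<theta> k \<le> prob (G k (m - 1))"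
      using not_less_Least[of "m - 1" "\<lambda>m. prob (G k m) < \<theta> k"] \<open>m > 1\<close> unfolding m_def[symmetric]
      by simp
    ultimately show ?thesis
      using m by (intro exI[of _ "m - 1"]) auto
  qed
  then obtain N where N: "\<And>k. 1 \<le> N k" "\<And>k. \<theta> k \<le> prob (G k (N k))"
    "\<And>k. prob (G k (N k + 1)) < \<theta> k"
    by metis
  have power: "prob (G k (j * m)) \<le> prob (G k m) ^ j" for k m j
  proof (induction j)
    case (Suc j)
    have "prob (G k (Suc j * m)) \<le> prob (G k m) * prob (G k (j * m))"
      using sub[of k m "j * m"] by simp
    also have "\<dots> \<le> prob (G k m) * prob (G k m) ^ j"
      by (intro mult_left_mono Suc) simp
    finally show ?case by simp
  qed simp
  have upper: "prob (G k (2 * (k + 2) ^ 3 * N k)) \<le> exp (- 1) ^ k" for k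
  proof -
    let ?j = "(k + 2) ^ 3"
    \<comment> \<open>Decay is available only from N + 1 on, where the probability is below the
      level; N + 1 \<le> 2 N accounts for the factor 2. The cube beats the square in 1 - 1/(k + 2)^2
      and leaves exp(-(k + 2)).\<close>
    have "?j * (N k + 1) \<le> ?j * (2 * N k)"
      using N(1)[of k] by (intro mult_left_mono) auto
    then have "prob (G k (2 * ?j * N k)) \<le> prob (G k (?j * (N k + 1)))"
      by (intro finite_measure_mono anti G) (simp add: ac_simps)
    also have "\<dots> \<le> prob (G k (N k + 1)) ^ ?j"
      by (rule power)
    also have "\<dots> \<le> \<theta> k ^ ?j"
      using N(3)[of k] by (intro power_mono) auto
    also have "\<dots> \<le> exp (- (1 / (real k + 2) ^ 2)) ^ ?j"
      using exp_ge_add_one_self[of "- (1 / (real k + 2) ^ 2)"] \<theta>(1)[of k]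
      by (intro power_mono) (simp_all add: \<theta>_def)
    also have "\<dots> = exp (real ?j * - (1 / (real k + 2) ^ 2))"
      by (rule exp_of_nat_mult[symmetric])
    also have "\<dots> = exp (- (real k + 2))"
    proof (rule arg_cong[where f = exp])
      have "x ^ 3 * - (1 / x ^ 2) = - x" for x :: real
        by (cases "x = 0") (simp_all add: power3_eq_cube power2_eq_square)
      from this[of "real k + 2"] show "real ?j * - (1 / (real k + 2) ^ 2) = - (real k + 2)"
        by (simp add: add.commute)
    qed
    also have "\<dots> \<le> exp (- 1) ^ k"
      by (simp add: exp_of_nat_mult[symmetric])
    finally show ?thesis .
  qed
  have lower: "prob (space M - G k (N k)) \<le> 1 / (real k + 2) ^ 2" for k
    using N(2)[of k] by (simp add: prob_compl G \<theta>_def)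
  have "summable (\<lambda>k. 1 / (real k + 2) ^ 2)"
  proof -
    have "summable (\<lambda>k. inverse (real (k + 2) ^ 2))"
      using inverse_power_summable[of 2, where 'a = real] by (subst summable_iff_shift) simp
    then show ?thesis by (simp add: inverse_eq_divide add.commute)
  qed
  then have "summable (\<lambda>k. prob (space M - G k (N k)))"
    by (rule summable_comparison_test') (use lower in simp)
  then have "AE \<omega> in M. eventually (\<lambda>k. \<omega> \<in> space M - (space M - G k (N k))) sequentially"
    by (intro borel_cantelli_AE1) (use G in \<open>auto simp: emeasure_eq_measure\<close>)
  moreover have "summable (\<lambda>k. exp (- 1 :: real) ^ k)"
    by (rule summable_geometric) simp
  then have "summable (\<lambda>k. prob (G k (2 * (k + 2) ^ 3 * N k)))"
    by (rule summable_comparison_test') (use upper in simp)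
  then have "AE \<omega> in M. eventually (\<lambda>k. \<omega> \<in> space M - G k (2 * (k + 2) ^ 3 * N k)) sequentially"
    by (intro borel_cantelli_AE1) (use G in \<open>auto simp: emeasure_eq_measure\<close>)
  ultimately have "AE \<omega> in M. eventually
      (\<lambda>k. \<omega> \<in> G k (N k) \<and> \<omega> \<notin> G k (2 * (k + 2) ^ 3 * N k)) sequentially"
  proof eventually_elim
    case (elim \<omega>)
    then show ?case by eventually_elim simp
  qed
  then show thesis
    using N(1) that by blast
qed

subsection \<open>Almost sure constancy of the dimensions\<close>

text \<open>The one-sided limits bound \<open>f\<close> on each side of a point, and the value at
  the point is one more vector; compactness of the interval reduces to finitely many such
  neighborhoods.\<close>

lemma cadlag_on_bounded:
  fixes f :: "real \<Rightarrow> 'a::real_normed_vector"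
  assumes "cadlag_on a b f"
  shows "bounded (f ` {a..b})"
proof -
  have "\<exists>d>0. bounded (f ` ({a..b} \<inter> ball t d))" if t: "t \<in> {a..b}" for t
  proof -
    have right: "\<exists>d>0. bounded (f ` ({t<..b} \<inter> ball t d))"
    proof (cases "t < b")
      case True
      then have "(f \<longlongrightarrow> f t) (at_right t)"
        using assms t unfolding cadlag_on_def by simp
      then have "eventually (\<lambda>s. dist (f s) (f t) < 1) (at_right t)"
        by (rule tendstoD) simp
      then obtain d where d: "0 < d" "\<And>s. t < s \<Longrightarrow> dist s t < d \<Longrightarrow> dist (f s) (f t) < 1"
        unfolding eventually_at by auto
      then have "f ` ({t<..b} \<inter> ball t d) \<subseteq> ball (f t) 1"
        by (auto simp: dist_commute)
      then show ?thesis
        using d(1) bounded_subset[OF bounded_ball] by blast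
    qed (auto intro: exI[of _ 1])
    have left: "\<exists>d>0. bounded (f ` ({a..<t} \<inter> ball t d))"
    proof (cases "a < t")
      case True
      then have "t \<in> {a<..b}"
        using t by simp
      then obtain l where "(f \<longlongrightarrow> l) (at_left t)"
        using assms unfolding cadlag_on_def by blast
      then have "eventually (\<lambda>s. dist (f s) l < 1) (at_left t)"
        by (rule tendstoD) simp
      then obtain d where d: "0 < d" "\<And>s. s < t \<Longrightarrow> dist s t < d \<Longrightarrow> dist (f s) l < 1"
        unfolding eventually_at by auto
      then have "f ` ({a..<t} \<inter> ball t d) \<subseteq> ball l 1"
        by (auto simp: dist_commute)
      then show ?thesis
        using d(1) bounded_subset[OF bounded_ball] by blast
    qed (auto intro: exI[of _ 1])
    from right left obtain d1 d2 where d: "0 < d1" "0 < d2"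
      "bounded (f ` ({t<..b} \<inter> ball t d1))" "bounded (f ` ({a..<t} \<inter> ball t d2))"
      by blast
    have "bounded (insert (f t) (f ` ({t<..b} \<inter> ball t d1) \<union> f ` ({a..<t} \<inter> ball t d2)))"
      using d by simp
    moreover have "f ` ({a..b} \<inter> ball t (min d1 d2)) \<subseteq>
        insert (f t) (f ` ({t<..b} \<inter> ball t d1) \<union> f ` ({a..<t} \<inter> ball t d2))"
      by (auto simp: not_less_iff_gr_or_eq image_iff Bex_def) force
    ultimately have "bounded (f ` ({a..b} \<inter> ball t (min d1 d2)))"
      by (rule bounded_subset)
    with d show ?thesis by (intro exI[of _ "min d1 d2"]) simp
  qed
  then obtain d where d: "\<And>t. t \<in> {a..b} \<Longrightarrow> 0 < d t"
    "\<And>t. t \<in> {a..b} \<Longrightarrow> bounded (f ` ({a..b} \<inter> ball t (d t)))"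
    by metis
  obtain T where T: "T \<subseteq> {a..b}" "finite T" "{a..b} \<subseteq> (\<Union>t\<in>T. ball t (d t))"
    by (rule compactE_image[of "{a..b}" "{a..b}" "\<lambda>t. ball t (d t)"]) (use d(1) in auto)
  have "bounded (\<Union>t\<in>T. f ` ({a..b} \<inter> ball t (d t)))"
    using T(1,2) d(2) by (intro bounded_UN) auto
  then show ?thesis
    by (rule bounded_subset) (use T(3) in blast)
qed

theorem theorem1p2:
  fixes M :: "'w measure"
    and B :: "real \<Rightarrow> 'w \<Rightarrow> real ^ 'd"
    and f :: "real \<Rightarrow> real ^ 'd"
    and A :: "real set"
  assumes "standard_brownian_motion M B"
    and "cadlag_on 0 1 f"
    and "A \<subseteq> {0..1}"
    and "A \<noteq> {}"
  shows "\<exists>c1 c2 :: real. AE \<omega> in M.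
           lower_minkowski_dim ((\<lambda>t. B t \<omega> + f t) ` A) = ereal c1 \<and>
           upper_minkowski_dim ((\<lambda>t. B t \<omega> + f t) ` A) = ereal c2"
proof -
  interpret standard_brownian_motion M B by fact
  define E where "E S \<omega> = (\<lambda>t. B t \<omega> + f t) ` S" for S \<omega>
  \<comment> \<open>Separability is applied to the graph of \<open>f\<close> over \<open>A\<close>,
    not to \<open>A\<close>: a dense set of times could omit a jump time that is approached only
    from the left, and thereby lose the value there.\<close>
  obtain D where D: "countable D" "D \<subseteq> (\<lambda>t. (t, f t)) ` A" "(\<lambda>t. (t, f t)) ` A \<subseteq> closure D"
    by (rule separable)
  define A' where "A' = fst ` D"
  have A': "countable A'" "A' \<subseteq> A" "A' \<subseteq> {0..}" "A' \<noteq> {}"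
    using D assms(3,4) by (auto simp: A'_def)
  \<comment> \<open>Convergence in the graph gives convergence of the times and of the values of
    \<open>f\<close> together; continuity of the path supplies the convergence of
    \<open>B\<close>.\<close>
  have dense: "E A \<omega> \<subseteq> closure (E A' \<omega>)" if cont: "continuous_on {0..} (\<lambda>t. B t \<omega>)" for \<omega>
  proof
    fix x assume "x \<in> E A \<omega>"
    then obtain t where t: "t \<in> A" "x = B t \<omega> + f t"
      by (auto simp: E_def)
    then have "(t, f t) \<in> closure D"
      using D(3) by blast
    then obtain z where z: "\<And>n. z n \<in> D" "z \<longlonglongrightarrow> (t, f t)"
      unfolding closure_sequential by blast
    define s where "s n = fst (z n)" for n
    have z_eq: "z n = (s n, f (s n))" for n
      using z(1)[of n] D(2) by (auto simp: s_def)
    have s: "s n \<in> A'" for n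
      using z(1) by (auto simp: s_def A'_def)
    have nonneg: "0 \<le> s n" for n
      using s[of n] A'(3) by auto
    have lim: "s \<longlonglongrightarrow> t" "(\<lambda>n. f (s n)) \<longlonglongrightarrow> f t"
      using tendsto_fst[OF z(2)] tendsto_snd[OF z(2)] by (simp_all add: z_eq)
    have "(\<lambda>n. B (s n) \<omega>) \<longlonglongrightarrow> B t \<omega>"
      by (rule continuous_on_tendsto_compose[OF cont lim(1)]) (use nonneg t(1) assms(3) in auto)
    then have "(\<lambda>n. B (s n) \<omega> + f (s n)) \<longlonglongrightarrow> x"
      unfolding t(2) using lim(2) by (rule tendsto_add)
    then show "x \<in> closure (E A' \<omega>)"
      unfolding closure_sequential using s
      by (intro exI[of _ "\<lambda>n. B (s n) \<omega> + f (s n)"]) (auto simp: E_def)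
  qed
  have bounded: "bounded (E A \<omega>)" if cont: "continuous_on {0..} (\<lambda>t. B t \<omega>)" for \<omega>
  proof -
    have "compact ((\<lambda>t. B t \<omega>) ` {0..1})"
      by (rule compact_continuous_image[OF continuous_on_subset[OF cont]]) auto
    then have "bounded ((\<lambda>t. B t \<omega>) ` {0..1})"
      by (rule compact_imp_bounded)
    then have "bounded (E {0..1} \<omega>)"
      unfolding E_def using cadlag_on_bounded[OF assms(2)] by (rule bounded_plus_comp)
    then show ?thesis
      by (rule bounded_subset) (use assms(3) in \<open>auto simp: E_def\<close>)
  qed
  have bounded': "bounded (E A' \<omega>)" if "continuous_on {0..} (\<lambda>t. B t \<omega>)" for \<omega>
    using bounded[OF that] by (rule bounded_subset) (use A' in \<open>auto simp: E_def\<close>)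
  define G where "G k m = {\<omega>\<in>space M. has_packing (\<lambda>t. B t \<omega> + f t) (2 * (1/2) ^ k) A' m}" for k m
  have G: "\<omega> \<in> G k m \<longleftrightarrow> \<omega> \<in> space M \<and> has_packing (\<lambda>x. x) (2 * (1/2) ^ k) (E A' \<omega>) m" for \<omega> k m
    unfolding G_def E_def by (subst has_packing_image) auto
  obtain N where N: "\<And>k. 1 \<le> N k"
    "AE \<omega> in M. eventually (\<lambda>k. \<omega> \<in> G k (N k) \<and> \<omega> \<notin> G k (2 * (k + 2) ^ 3 * N k)) sequentially"
  proof (rule submultiplicative_concentration[of G])
    show events: "G k m \<in> events" for k m
      unfolding G_def using A' by (intro has_packing_events)
    show "G k m' \<subseteq> G k m" if "m \<le> m'" for k m m'
      unfolding G_def using that has_packing_mono by blast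
    show "G k 1 = space M" for k
      unfolding G_def using has_packing_1[OF A'(4)] by auto
    show "prob (G k (m + l)) \<le> prob (G k m) * prob (G k l)" for k m l
      unfolding G_def using A' by (intro has_packing_submultiplicative_countable)
    \<comment> \<open>On a continuous path the image is bounded, so a packing with one member more
      than the packing number is impossible.\<close>
    show "prob (\<Inter>m. G k m) = 0" for k
    proof (subst prob_eq_0)
      show "(\<Inter>m. G k m) \<in> events"
        using events by auto
      show "AE \<omega> in M. \<omega> \<notin> (\<Inter>m. G k m)"
        using continuous_B
      proof eventually_elim
        case (elim \<omega>)
        have "\<not> has_packing (\<lambda>x. x) (2 * (1/2) ^ k) (E A' \<omega>)
            (Suc (packing_number (E A' \<omega>) ((1/2) ^ k)))"
          using le_packing_number_iff[OF bounded'[OF elim], of "(1/2) ^ k"] by force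
        then show ?case
          unfolding INT_iff G by blast
      qed
    qed
  qed (rule that)
  define a where "a k = ln (real (N k)) / (real k * ln 2)" for k
  have dims: "AE \<omega> in M. lower_minkowski_dim (E A \<omega>) = liminf (\<lambda>k. ereal (a k)) \<and>
      upper_minkowski_dim (E A \<omega>) = limsup (\<lambda>k. ereal (a k)) \<and>
      (\<exists>K. eventually (\<lambda>k. 0 \<le> a k \<and> a k \<le> K) sequentially)"
    using continuous_B N(2) AE_space
  proof eventually_elim
    case (elim \<omega>)
    note bdd = bounded[OF elim(1)]
    have "\<forall>\<^sub>F k in sequentially. 1 \<le> N k \<and> N k \<le> packing_number (E A \<omega>) ((1/2) ^ k)"
      using elim(2)
    proof eventually_elim
      case (elim k)
      then have "has_packing (\<lambda>x. x) (2 * (1/2) ^ k) (E A' \<omega>) (N k)"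
        unfolding G by blast
      then have "has_packing (\<lambda>x. x) (2 * (1/2) ^ k) (E A \<omega>) (N k)"
        by (rule has_packing_mono) (use A' in \<open>auto simp: E_def\<close>)
      then show ?case
        using N(1) le_packing_number_iff[OF bdd, of "(1/2) ^ k"] by simp
    qed
    moreover have "\<forall>\<^sub>F k in sequentially.
        packing_number (E A \<omega>) ((1/2) ^ k) \<le> 2 * (k + 3) ^ 3 * N (Suc k)"
    proof -
      \<comment> \<open>Separation 2 * 2^-k on \<open>A\<close> becomes separation 2^-k = 2 * 2^-(k
        + 1) on the dense subset, so the event with index \<open>Suc k\<close> is the one to
        exclude.\<close>
      have "\<forall>\<^sub>F k in sequentially. \<omega> \<notin> G (Suc k) (2 * (Suc k + 2) ^ 3 * N (Suc k))"
        using elim(2) by (subst eventually_sequentially_Suc) (auto elim: eventually_mono)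
      then show ?thesis
      proof eventually_elim
        case (elim k)
        let ?m = "2 * (k + 3) ^ 3 * N (Suc k)"
        show ?case
        proof (rule ccontr)
          assume "\<not> packing_number (E A \<omega>) ((1/2) ^ k) \<le> ?m"
          then have "has_packing (\<lambda>x. x) (2 * (1/2) ^ k) (E A \<omega>) ?m"
            using le_packing_number_iff[OF bdd, of "(1/2) ^ k" ?m] by simp
          then have "has_packing (\<lambda>x. x) ((1/2) ^ k) (E A' \<omega>) ?m"
            by (rule has_packing_dense) (use dense \<open>continuous_on {0..} (\<lambda>t. B t \<omega>)\<close> in auto)
          then have "\<omega> \<in> G (Suc k) ?m"
            unfolding G using \<open>\<omega> \<in> space M\<close> by simp
          with elim show False
            by (simp add: numeral_3_eq_3)
        qed
      qed
    qed
    ultimately show ?case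
      unfolding a_def using minkowski_dim_eq_sequence[OF bdd, of N] by blast
  qed
  \<comment> \<open>The bound concerns only the deterministic sequence \<open>a\<close>, so holding
    almost surely on a probability space it simply holds.\<close>
  then have "AE \<omega> in M. \<exists>K. eventually (\<lambda>k. 0 \<le> a k \<and> a k \<le> K) sequentially"
    by eventually_elim blast
  then obtain K where "eventually (\<lambda>k. 0 \<le> a k \<and> a k \<le> K) sequentially"
    by auto
  then obtain c1 c2 where "liminf (\<lambda>k. ereal (a k)) = ereal c1" "limsup (\<lambda>k. ereal (a k)) = ereal c2"
    using Liminf_Limsup_real_between by blast
  with dims show ?thesis
    unfolding E_def by (intro exI[of _ c1] exI[of _ c2]) auto
qed

end
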